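(* There is a signature $\Sigma$ and a sentence $\phi$ of $\mathsf{InqBQ}$ in $\Sigma$ such that there is no sentence $\phi^*$ of two-sorted first-order logic in the signature $\Sigma^*$ with the property that for every first-order information model $M$ for $\Sigma$: $M\models\phi$ iff $M^*\models\phi^*$.
   Context: $\mathsf{InqBQ}$ formulas: $\phi ::= p \mid \bot \mid (\phi\wedge\phi)\mid(\phi\veebar\phi)\mid(\phi\to\phi)\mid\forall x\phi\mid\exists^{\mathrm{i}}x\phi$, with $p$ first-order atoms. A first-order information model for $\Sigma$ is $M=(W,D,I)$ with non-empty sets $W$ (worlds) and $D$ (individuals), and for each $w\in W$ an interpretation $I_w$ assigning to each $n$-ary relation symbol $R$ a relation $R_w\subseteq D^n$ and to each $n$-ary function symbol $f$ a function $f_w:D^n\to D$. Terms are evaluated at world $w$ and assignment $g$ as $[t]^g_w$. Support $M,s\models_g\phi$ for a state $s\subseteq W$: $M,s\models_g R(t_1,\dots,t_n)$ iff $([t_1]^g_w,\dots,[t_n]^g_w)\in R_w$ for all $w\in s$; $M,s\models_g t_1=t_2$ iff $[t_1]^g_w=[t_2]^g_w$ for all $w\in s$; $\bot$ iff $s=\emptyset$; $\wedge$ conjunction; $\phi\veebar\psi$ iff $\phi$ or $\psi$ supported; $\phi\to\psi$ iff every $t\subseteq s$ supporting $\phi$ supports $\psi$; $\forall x\phi$ iff $M,s\models_{g[x\mapsto d]}\phi$ for all $d\in D$; $\exists^{\mathrm{i}}x\phi$ iff for some $d\in D$. For a sentence, $M\models\phi$ means $M,W\models_g\phi$ (for any $g$).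 The signature $\Sigma^*$ is two-sorted, with sorts $\mathtt{w}$ (worlds) and $\mathtt{e}$ (individuals): each $n$-ary predicate $P\in\Sigma$ yields an $(n+1)$-ary predicate $P^*$ whose first argument has sort $\mathtt{w}$ and the others sort $\mathtt{e}$; each $n$-ary function symbol $f\in\Sigma$ yields an $(n+1)$-ary function symbol $f^*$ with first argument of sort $\mathtt{w}$ and other arguments and output of sort $\mathtt{e}$. The encoding $M^*=(W,D,I^* )$ is the two-sorted structure with $(w,\bar d)\in I^*(P^* )$ iff $\bar d\in I_w(P)$ and $I^*(f^* )(w,\bar d)=I_w(f)(\bar d)$. *)

theory Defs
  imports "HOL-Library.NList"
begin

record ('r, 'f) signature =
  rel_syms :: "'r set"
  fun_syms :: "'f set"
  rel_arity :: "'r \<Rightarrow> nat"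
  fun_arity :: "'f \<Rightarrow> nat"


section \<open>Syntax of InqBQ\<close>

datatype 'f trm = Var nat | Fn 'f "'f trm list"

datatype ('r, 'f) inq =
    Rel 'r "'f trm list"
  | Eq "'f trm" "'f trm"
  | Bot
  | Conj "('r, 'f) inq" "('r, 'f) inq"
  | IDisj "('r, 'f) inq" "('r, 'f) inq"
  | Imp "('r, 'f) inq" "('r, 'f) inq"
  | All nat "('r, 'f) inq"
  | IEx nat "('r, 'f) inq"

fun trm_over :: "('r, 'f) signature \<Rightarrow> 'f trm \<Rightarrow> bool" where
  "trm_over \<Sigma> (Var x) \<longleftrightarrow> True"
| "trm_over \<Sigma> (Fn f ts) \<longleftrightarrow>
     f \<in> fun_syms \<Sigma> \<and> length ts = fun_arity \<Sigma> f \<and> (\<forall>t\<in>set ts. trm_over \<Sigma> t)"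

fun inq_over :: "('r, 'f) signature \<Rightarrow> ('r, 'f) inq \<Rightarrow> bool" where
  "inq_over \<Sigma> (Rel R ts) \<longleftrightarrow>
     R \<in> rel_syms \<Sigma> \<and> length ts = rel_arity \<Sigma> R \<and> (\<forall>t\<in>set ts. trm_over \<Sigma> t)"
| "inq_over \<Sigma> (Eq t u) \<longleftrightarrow> trm_over \<Sigma> t \<and> trm_over \<Sigma> u"
| "inq_over \<Sigma> Bot \<longleftrightarrow> True"
| "inq_over \<Sigma> (Conj \<phi> \<psi>) \<longleftrightarrow> inq_over \<Sigma> \<phi> \<and> inq_over \<Sigma> \<psi>"
| "inq_over \<Sigma> (IDisj \<phi> \<psi>) \<longleftrightarrow> inq_over \<Sigma> \<phi> \<and> inq_over \<Sigma> \<psi>"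
| "inq_over \<Sigma> (Imp \<phi> \<psi>) \<longleftrightarrow> inq_over \<Sigma> \<phi> \<and> inq_over \<Sigma> \<psi>"
| "inq_over \<Sigma> (All x \<phi>) \<longleftrightarrow> inq_over \<Sigma> \<phi>"
| "inq_over \<Sigma> (IEx x \<phi>) \<longleftrightarrow> inq_over \<Sigma> \<phi>"

fun trm_fv :: "'f trm \<Rightarrow> nat set" where
  "trm_fv (Var x) = {x}"
| "trm_fv (Fn f ts) = (\<Union>t\<in>set ts. trm_fv t)"

fun inq_fv :: "('r, 'f) inq \<Rightarrow> nat set" where
  "inq_fv (Rel R ts) = (\<Union>t\<in>set ts. trm_fv t)"
| "inq_fv (Eq t u) = trm_fv t \<union> trm_fv u"
| "inq_fv Bot = {}"
| "inq_fv (Conj \<phi> \<psi>) = inq_fv \<phi> \<union> inq_fv \<psi>"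
| "inq_fv (IDisj \<phi> \<psi>) = inq_fv \<phi> \<union> inq_fv \<psi>"
| "inq_fv (Imp \<phi> \<psi>) = inq_fv \<phi> \<union> inq_fv \<psi>"
| "inq_fv (All x \<phi>) = inq_fv \<phi> - {x}"
| "inq_fv (IEx x \<phi>) = inq_fv \<phi> - {x}"

definition inq_sentence :: "('r, 'f) signature \<Rightarrow> ('r, 'f) inq \<Rightarrow> bool" where
  "inq_sentence \<Sigma> \<phi> \<longleftrightarrow> inq_over \<Sigma> \<phi> \<and> inq_fv \<phi> = {}"


section \<open>Information models and support\<close>

record ('w, 'd, 'r, 'f) info_model =
  worlds :: "'w set"
  indivs :: "'d set"
  rel_at :: "'w \<Rightarrow> 'r \<Rightarrow> 'd list set"
  fun_at :: "'w \<Rightarrow> 'f \<Rightarrow> 'd list \<Rightarrow> 'd"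

text \<open>Only the symbols of the signature are constrained; formulas over the signature do not
  depend on how other symbols are interpreted.\<close>

definition is_info_model ::
  "('r, 'f) signature \<Rightarrow> ('w, 'd, 'r, 'f) info_model \<Rightarrow> bool" where
  "is_info_model \<Sigma> M \<longleftrightarrow>
     worlds M \<noteq> {} \<and> indivs M \<noteq> {} \<and>
     (\<forall>w\<in>worlds M.
        (\<forall>R\<in>rel_syms \<Sigma>. rel_at M w R \<subseteq> nlists (rel_arity \<Sigma> R) (indivs M)) \<and>
        (\<forall>f\<in>fun_syms \<Sigma>. \<forall>ds\<in>nlists (fun_arity \<Sigma> f) (indivs M). fun_at M w f ds \<in> indivs M))"

fun trm_val ::
  "('w, 'd, 'r, 'f) info_model \<Rightarrow> (nat \<Rightarrow> 'd) \<Rightarrow> 'w \<Rightarrow> 'f trm \<Rightarrow> 'd" where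
  "trm_val M g w (Var x) = g x"
| "trm_val M g w (Fn f ts) = fun_at M w f (map (trm_val M g w) ts)"

fun supports ::
  "('w, 'd, 'r, 'f) info_model \<Rightarrow> 'w set \<Rightarrow> (nat \<Rightarrow> 'd) \<Rightarrow> ('r, 'f) inq \<Rightarrow> bool" where
  "supports M s g (Rel R ts) \<longleftrightarrow> (\<forall>w\<in>s. map (trm_val M g w) ts \<in> rel_at M w R)"
| "supports M s g (Eq t u) \<longleftrightarrow> (\<forall>w\<in>s. trm_val M g w t = trm_val M g w u)"
| "supports M s g Bot \<longleftrightarrow> s = {}"
| "supports M s g (Conj \<phi> \<psi>) \<longleftrightarrow> supports M s g \<phi> \<and> supports M s g \<psi>"
| "supports M s g (IDisj \<phi> \<psi>) \<longleftrightarrow> supports M s g \<phi> \<or> supports M s g \<psi>"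
| "supports M s g (Imp \<phi> \<psi>) \<longleftrightarrow> (\<forall>t. t \<subseteq> s \<longrightarrow> supports M t g \<phi> \<longrightarrow> supports M t g \<psi>)"
| "supports M s g (All x \<phi>) \<longleftrightarrow> (\<forall>d\<in>indivs M. supports M s (g(x := d)) \<phi>)"
| "supports M s g (IEx x \<phi>) \<longleftrightarrow> (\<exists>d\<in>indivs M. supports M s (g(x := d)) \<phi>)"

definition inq_models :: "('w, 'd, 'r, 'f) info_model \<Rightarrow> ('r, 'f) inq \<Rightarrow> bool" where
  "inq_models M \<phi> \<longleftrightarrow>
     (\<forall>g. (\<forall>x. g x \<in> indivs M) \<longrightarrow> supports M (worlds M) g \<phi>)"


section \<open>Two-sorted first-order logic over the starred signature\<close>

text \<open>The syntax is that of the two-sorted signature \<open>\<Sigma>\<^sup>*\<close>: a symbol of \<open>\<Sigma>\<close> of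
  arity \<open>n\<close> takes one argument of sort \<open>w\<close> followed by \<open>n\<close> arguments of sort \<open>e\<close>.  Every
  function symbol of \<open>\<Sigma>\<^sup>*\<close> has output sort \<open>e\<close>, so the only terms of sort \<open>w\<close> are variables,
  given by their index.  The two sorts have disjoint supplies of variables, and equality is
  available in both.\<close>

datatype 'f etrm = EVar nat | EFn 'f nat "'f etrm list"

datatype ('r, 'f) tsfm =
    TRel 'r nat "'f etrm list"
  | TEqW nat nat
  | TEqE "'f etrm" "'f etrm"
  | TBot
  | TNeg "('r, 'f) tsfm"
  | TConj "('r, 'f) tsfm" "('r, 'f) tsfm"
  | TDisj "('r, 'f) tsfm" "('r, 'f) tsfm"
  | TImp "('r, 'f) tsfm" "('r, 'f) tsfm"
  | TAllW nat "('r, 'f) tsfm"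
  | TExW nat "('r, 'f) tsfm"
  | TAllE nat "('r, 'f) tsfm"
  | TExE nat "('r, 'f) tsfm"

fun etrm_over :: "('r, 'f) signature \<Rightarrow> 'f etrm \<Rightarrow> bool" where
  "etrm_over \<Sigma> (EVar x) \<longleftrightarrow> True"
| "etrm_over \<Sigma> (EFn f v ts) \<longleftrightarrow>
     f \<in> fun_syms \<Sigma> \<and> length ts = fun_arity \<Sigma> f \<and> (\<forall>t\<in>set ts. etrm_over \<Sigma> t)"

fun tsfm_over :: "('r, 'f) signature \<Rightarrow> ('r, 'f) tsfm \<Rightarrow> bool" where
  "tsfm_over \<Sigma> (TRel R v ts) \<longleftrightarrow>
     R \<in> rel_syms \<Sigma> \<and> length ts = rel_arity \<Sigma> R \<and> (\<forall>t\<in>set ts. etrm_over \<Sigma> t)"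
| "tsfm_over \<Sigma> (TEqW u v) \<longleftrightarrow> True"
| "tsfm_over \<Sigma> (TEqE t u) \<longleftrightarrow> etrm_over \<Sigma> t \<and> etrm_over \<Sigma> u"
| "tsfm_over \<Sigma> TBot \<longleftrightarrow> True"
| "tsfm_over \<Sigma> (TNeg \<alpha>) \<longleftrightarrow> tsfm_over \<Sigma> \<alpha>"
| "tsfm_over \<Sigma> (TConj \<alpha> \<beta>) \<longleftrightarrow> tsfm_over \<Sigma> \<alpha> \<and> tsfm_over \<Sigma> \<beta>"
| "tsfm_over \<Sigma> (TDisj \<alpha> \<beta>) \<longleftrightarrow> tsfm_over \<Sigma> \<alpha> \<and> tsfm_over \<Sigma> \<beta>"
| "tsfm_over \<Sigma> (TImp \<alpha> \<beta>) \<longleftrightarrow> tsfm_over \<Sigma> \<alpha> \<and> tsfm_over \<Sigma> \<beta>"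
| "tsfm_over \<Sigma> (TAllW v \<alpha>) \<longleftrightarrow> tsfm_over \<Sigma> \<alpha>"
| "tsfm_over \<Sigma> (TExW v \<alpha>) \<longleftrightarrow> tsfm_over \<Sigma> \<alpha>"
| "tsfm_over \<Sigma> (TAllE x \<alpha>) \<longleftrightarrow> tsfm_over \<Sigma> \<alpha>"
| "tsfm_over \<Sigma> (TExE x \<alpha>) \<longleftrightarrow> tsfm_over \<Sigma> \<alpha>"

fun etrm_fvW :: "'f etrm \<Rightarrow> nat set" where
  "etrm_fvW (EVar x) = {}"
| "etrm_fvW (EFn f v ts) = {v} \<union> (\<Union>t\<in>set ts. etrm_fvW t)"

fun etrm_fvE :: "'f etrm \<Rightarrow> nat set" where
  "etrm_fvE (EVar x) = {x}"
| "etrm_fvE (EFn f v ts) = (\<Union>t\<in>set ts. etrm_fvE t)"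

fun tsfm_fvW :: "('r, 'f) tsfm \<Rightarrow> nat set" where
  "tsfm_fvW (TRel R v ts) = {v} \<union> (\<Union>t\<in>set ts. etrm_fvW t)"
| "tsfm_fvW (TEqW u v) = {u, v}"
| "tsfm_fvW (TEqE t u) = etrm_fvW t \<union> etrm_fvW u"
| "tsfm_fvW TBot = {}"
| "tsfm_fvW (TNeg \<alpha>) = tsfm_fvW \<alpha>"
| "tsfm_fvW (TConj \<alpha> \<beta>) = tsfm_fvW \<alpha> \<union> tsfm_fvW \<beta>"
| "tsfm_fvW (TDisj \<alpha> \<beta>) = tsfm_fvW \<alpha> \<union> tsfm_fvW \<beta>"
| "tsfm_fvW (TImp \<alpha> \<beta>) = tsfm_fvW \<alpha> \<union> tsfm_fvW \<beta>"
| "tsfm_fvW (TAllW v \<alpha>) = tsfm_fvW \<alpha> - {v}"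
| "tsfm_fvW (TExW v \<alpha>) = tsfm_fvW \<alpha> - {v}"
| "tsfm_fvW (TAllE x \<alpha>) = tsfm_fvW \<alpha>"
| "tsfm_fvW (TExE x \<alpha>) = tsfm_fvW \<alpha>"

fun tsfm_fvE :: "('r, 'f) tsfm \<Rightarrow> nat set" where
  "tsfm_fvE (TRel R v ts) = (\<Union>t\<in>set ts. etrm_fvE t)"
| "tsfm_fvE (TEqW u v) = {}"
| "tsfm_fvE (TEqE t u) = etrm_fvE t \<union> etrm_fvE u"
| "tsfm_fvE TBot = {}"
| "tsfm_fvE (TNeg \<alpha>) = tsfm_fvE \<alpha>"
| "tsfm_fvE (TConj \<alpha> \<beta>) = tsfm_fvE \<alpha> \<union> tsfm_fvE \<beta>"
| "tsfm_fvE (TDisj \<alpha> \<beta>) = tsfm_fvE \<alpha> \<union> tsfm_fvE \<beta>"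
| "tsfm_fvE (TImp \<alpha> \<beta>) = tsfm_fvE \<alpha> \<union> tsfm_fvE \<beta>"
| "tsfm_fvE (TAllW v \<alpha>) = tsfm_fvE \<alpha>"
| "tsfm_fvE (TExW v \<alpha>) = tsfm_fvE \<alpha>"
| "tsfm_fvE (TAllE x \<alpha>) = tsfm_fvE \<alpha> - {x}"
| "tsfm_fvE (TExE x \<alpha>) = tsfm_fvE \<alpha> - {x}"

definition ts_sentence :: "('r, 'f) signature \<Rightarrow> ('r, 'f) tsfm \<Rightarrow> bool" where
  "ts_sentence \<Sigma> \<alpha> \<longleftrightarrow> tsfm_over \<Sigma> \<alpha> \<and> tsfm_fvW \<alpha> = {} \<and> tsfm_fvE \<alpha> = {}"

record ('w, 'd, 'r, 'f) ts_structure =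
  domW :: "'w set"
  domE :: "'d set"
  ts_rel :: "'r \<Rightarrow> ('w \<times> 'd list) set"
  ts_fun :: "'f \<Rightarrow> 'w \<times> 'd list \<Rightarrow> 'd"

fun etrm_val ::
  "('w, 'd, 'r, 'f) ts_structure \<Rightarrow> (nat \<Rightarrow> 'w) \<Rightarrow> (nat \<Rightarrow> 'd) \<Rightarrow> 'f etrm \<Rightarrow> 'd" where
  "etrm_val S h g (EVar x) = g x"
| "etrm_val S h g (EFn f v ts) = ts_fun S f (h v, map (etrm_val S h g) ts)"

fun ts_sat ::
  "('w, 'd, 'r, 'f) ts_structure \<Rightarrow> (nat \<Rightarrow> 'w) \<Rightarrow> (nat \<Rightarrow> 'd) \<Rightarrow> ('r, 'f) tsfm \<Rightarrow> bool" where
  "ts_sat S h g (TRel R v ts) \<longleftrightarrow> (h v, map (etrm_val S h g) ts) \<in> ts_rel S R"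
| "ts_sat S h g (TEqW u v) \<longleftrightarrow> h u = h v"
| "ts_sat S h g (TEqE t u) \<longleftrightarrow> etrm_val S h g t = etrm_val S h g u"
| "ts_sat S h g TBot \<longleftrightarrow> False"
| "ts_sat S h g (TNeg \<alpha>) \<longleftrightarrow> \<not> ts_sat S h g \<alpha>"
| "ts_sat S h g (TConj \<alpha> \<beta>) \<longleftrightarrow> ts_sat S h g \<alpha> \<and> ts_sat S h g \<beta>"
| "ts_sat S h g (TDisj \<alpha> \<beta>) \<longleftrightarrow> ts_sat S h g \<alpha> \<or> ts_sat S h g \<beta>"
| "ts_sat S h g (TImp \<alpha> \<beta>) \<longleftrightarrow> (ts_sat S h g \<alpha> \<longrightarrow> ts_sat S h g \<beta>)"
| "ts_sat S h g (TAllW v \<alpha>) \<longleftrightarrow> (\<forall>w\<in>domW S. ts_sat S (h(v := w)) g \<alpha>)"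
| "ts_sat S h g (TExW v \<alpha>) \<longleftrightarrow> (\<exists>w\<in>domW S. ts_sat S (h(v := w)) g \<alpha>)"
| "ts_sat S h g (TAllE x \<alpha>) \<longleftrightarrow> (\<forall>d\<in>domE S. ts_sat S h (g(x := d)) \<alpha>)"
| "ts_sat S h g (TExE x \<alpha>) \<longleftrightarrow> (\<exists>d\<in>domE S. ts_sat S h (g(x := d)) \<alpha>)"

definition ts_models :: "('w, 'd, 'r, 'f) ts_structure \<Rightarrow> ('r, 'f) tsfm \<Rightarrow> bool" where
  "ts_models S \<alpha> \<longleftrightarrow>
     (\<forall>h g. (\<forall>v. h v \<in> domW S) \<longrightarrow> (\<forall>x. g x \<in> domE S) \<longrightarrow> ts_sat S h g \<alpha>)"

definition encoding ::
  "('w, 'd, 'r, 'f) info_model \<Rightarrow> ('w, 'd, 'r, 'f) ts_structure" where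
  "encoding M =
     \<lparr> domW = worlds M,
       domE = indivs M,
       ts_rel = (\<lambda>R. {(w, ds). w \<in> worlds M \<and> ds \<in> rel_at M w R}),
       ts_fun = (\<lambda>f (w, ds). fun_at M w f ds) \<rparr>"

end

theory Submission
  imports Defs "HOL-Library.Disjoint_Sets"
begin

text \<open>
  Take the model whose worlds are the two-element subsets of a finite set \<open>D\<close> of individuals, with
  one unary predicate that holds of \<open>d\<close> at \<open>w\<close> iff \<open>d \<in> w\<close>. A state is then a graph on \<open>D\<close>.
  Support for the antecedent of \<open>no_perfect_matching\<close> says that the state is a matching, support for
  its consequent that the state leaves some individual uncovered. As implication quantifies over
  all substates, the sentence says that \<open>D\<close> has no perfect matching, i.e. that \<open>|D|\<close> is odd.
  By an Ehrenfeucht-Fraisse argument no two-sorted first-order sentence detects this: partial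
  injections between two large sets \<open>D\<close>, \<open>D'\<close> can always be extended, and choosing a world costs
  at most two new individuals.
\<close>

section \<open>Models whose worlds are the edges of a complete graph\<close>

definition edge_sig :: "(nat, nat) signature" where
  "edge_sig = \<lparr> rel_syms = {0}, fun_syms = {}, rel_arity = (\<lambda>_. 1), fun_arity = (\<lambda>_. 0) \<rparr>"

text \<open>The type of worlds is arbitrary, so a world need not itself be a pair of individuals;
  the labelling \<open>e\<close> gives the edge that it stands for.\<close>

definition edge_model ::
  "'d set \<Rightarrow> 'w set \<Rightarrow> ('w \<Rightarrow> 'd set) \<Rightarrow> ('w, 'd, nat, nat) info_model" where
  "edge_model D W e =
     \<lparr> worlds = W, indivs = D, rel_at = (\<lambda>w _. {[d] |d. d \<in> e w}), fun_at = (\<lambda>_ _ _. undefined) \<rparr>"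

lemma edge_model_simps [simp]:
  "worlds (edge_model D W e) = W"
  "indivs (edge_model D W e) = D"
  "[d] \<in> rel_at (edge_model D W e) w R \<longleftrightarrow> d \<in> e w"
  by (simp_all add: edge_model_def)

abbreviation edges :: "'d set \<Rightarrow> 'd set set" where
  "edges D \<equiv> {s. s \<subseteq> D \<and> card s = 2}"

lemma edge_model_is_info_model:
  assumes "D \<noteq> {}" "W \<noteq> {}" "bij_betw e W (edges D)"
  shows "is_info_model edge_sig (edge_model D W e)"
proof -
  have "{[d] |d. d \<in> e w} \<subseteq> nlists 1 D" if "w \<in> W" for w
  proof -
    have "e w \<subseteq> D"
      using bij_betw_apply[OF assms(3) that] by simp
    then have "[d] \<in> nlists 1 D" if "d \<in> e w" for d
      using that subsetD by (intro nlistsI) simp_all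
    then show ?thesis
      by blast
  qed
  with assms(1,2) show ?thesis
    by (simp add: is_info_model_def edge_sig_def edge_model_def)
qed

lemma ex_edge_labelling:
  assumes "infinite (UNIV :: 'w set)" and "finite D"
  obtains W :: "'w set" and e where "bij_betw e W (edges D)"
proof -
  have fin: "finite (edges D)"
    using assms(2) by simp
  obtain W :: "'w set" where "finite W" "card W = card (edges D)"
    using infinite_arbitrarily_large[OF assms(1)] by blast
  with fin show thesis
    using finite_same_card_bij that by metis
qed

lemma ex_assignment: "A \<noteq> {} \<Longrightarrow> \<exists>g :: nat \<Rightarrow> _. \<forall>x. g x \<in> A"
  by (rule exI[of _ "\<lambda>_. SOME a. a \<in> A"]) (simp add: some_in_eq)

section \<open>The sentence\<close>

text \<open>Variables are rigid, so for distinct x, y, z and a nonempty state the last two disjuncts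
  decide: edge xy or edge xz is absent from the whole state. Inquisitive disjunction is essential,
  since at each single world one of the two edges is absent anyway.\<close>

definition no_perfect_matching :: "(nat, nat) inq" where
  "no_perfect_matching =
     Imp
       (All 0 (All 1 (All 2
         (IDisj (Eq (Var 0) (Var 1)) (IDisj (Eq (Var 0) (Var 2)) (IDisj (Eq (Var 1) (Var 2))
         (IDisj
           (Imp (Conj (Rel 0 [Var 0]) (Rel 0 [Var 1])) Bot)
           (Imp (Conj (Rel 0 [Var 0]) (Rel 0 [Var 2])) Bot))))))))
       (IEx 0 (Imp (Rel 0 [Var 0]) Bot))"

lemma no_perfect_matching_sentence: "inq_sentence edge_sig no_perfect_matching"
  by (auto simp: inq_sentence_def no_perfect_matching_def edge_sig_def)

text \<open>This unfolds support of a negation \<open>Imp _ Bot\<close>: a world satisfying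
  \<open>P\<close> already refutes it through its singleton substate.\<close>

lemma all_substates_empty_iff:
  "(\<forall>u. u \<subseteq> t \<longrightarrow> (\<forall>w\<in>u. P w) \<longrightarrow> u = {}) \<longleftrightarrow> (\<forall>w\<in>t. \<not> P w)"
proof
  assume *: "\<forall>u. u \<subseteq> t \<longrightarrow> (\<forall>w\<in>u. P w) \<longrightarrow> u = {}"
  show "\<forall>w\<in>t. \<not> P w"
    using *[rule_format, of "{w}" for w] by auto
qed blast

lemma supports_no_perfect_matching_iff:
  "supports (edge_model D W e) W g no_perfect_matching \<longleftrightarrow>
     (\<forall>t\<subseteq>W.
        (\<forall>x\<in>D. \<forall>y\<in>D. \<forall>z\<in>D. (\<forall>w\<in>t. x = y) \<or> (\<forall>w\<in>t. x = z) \<or> (\<forall>w\<in>t. y = z) \<or>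
           (\<forall>w\<in>t. \<not> (x \<in> e w \<and> y \<in> e w)) \<or> (\<forall>w\<in>t. \<not> (x \<in> e w \<and> z \<in> e w))) \<longrightarrow>
        (\<exists>x\<in>D. \<forall>w\<in>t. x \<notin> e w))"
  \<comment> \<open>Reversing \<open>ball_conj_distrib\<close> merges the two atoms of a conjunction
    into one predicate of the world, the shape that \<open>all_substates_empty_iff\<close>
    expects.\<close>
  by (simp add: no_perfect_matching_def all_substates_empty_iff flip: ball_conj_distrib)

section \<open>Perfect matchings and parity\<close>

lemma ex_perfect_matching:
  "finite D \<Longrightarrow> card D = 2 * n \<Longrightarrow> \<exists>C\<subseteq>edges D. \<Union>C = D \<and> disjoint C"
proof (induction n arbitrary: D)
  case 0
  then show ?case by (intro exI[of _ "{}"]) auto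
next
  case (Suc n)
  \<comment> \<open>Any pair can start the matching; the rest of \<open>D\<close> is matched by
    induction.\<close>
  obtain s where s: "s \<subseteq> D" "card s = 2" "finite s"
    using obtain_subset_with_card_n[of 2 D] Suc.prems by auto
  have "card (D - s) = 2 * n"
    using s Suc.prems by (simp add: card_Diff_subset)
  then obtain C where C: "C \<subseteq> edges (D - s)" "\<Union>C = D - s" "disjoint C"
    using Suc.IH[of "D - s"] Suc.prems(1) by (elim exE conjE meta_impE) simp_all
  have "disjoint (insert s C)"
    using C by (auto simp: disjoint_def)
  moreover have "insert s C \<subseteq> edges D"
    using C(1) s by auto
  moreover have "\<Union>(insert s C) = D"
    using C(2) s(1) by auto
  ultimately show ?case
    by blast
qed

lemma card_Union_edges:
  assumes "finite C" "disjoint C" "\<And>s. s \<in> C \<Longrightarrow> card s = 2"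
  shows "card (\<Union>C) = 2 * card C"
proof -
  have "card (\<Union>C) = sum card C"
    using assms by (intro card_Union_disjoint) (auto simp: disjoint_def pairwise_def disjnt_def
        intro: card_ge_0_finite)
  also have "\<dots> = 2 * card C"
    using assms(3) by simp
  finally show ?thesis .
qed

text \<open>A matching that covers \<open>D\<close> partitions it into pairs, so a refuting substate
  exists exactly when \<open>card D\<close> is even.\<close>

lemma inq_models_no_perfect_matching_iff:
  assumes fin: "finite D" and ne: "D \<noteq> {}" and bij: "bij_betw e W (edges D)"
  shows "inq_models (edge_model D W e) no_perfect_matching \<longleftrightarrow> odd (card D)"
proof -
  have edge: "e w \<subseteq> D" "card (e w) = 2" if "w \<in> W" for w
    using bij_betw_apply[OF bij that] by auto
  have inj: "inj_on e W" and im: "e ` W = edges D"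
    using bij by (auto simp: bij_betw_def)
  have finW: "finite W"
    using bij_betw_finite[OF bij] fin by simp
  let ?matching = "\<lambda>t. \<forall>x\<in>D. \<forall>y\<in>D. \<forall>z\<in>D. (\<forall>w\<in>t. x = y) \<or> (\<forall>w\<in>t. x = z) \<or> (\<forall>w\<in>t. y = z) \<or>
           (\<forall>w\<in>t. \<not> (x \<in> e w \<and> y \<in> e w)) \<or> (\<forall>w\<in>t. \<not> (x \<in> e w \<and> z \<in> e w))"
  have "(\<forall>t\<subseteq>W. ?matching t \<longrightarrow> (\<exists>x\<in>D. \<forall>w\<in>t. x \<notin> e w)) \<longleftrightarrow> odd (card D)"
  proof
    assume *: "\<forall>t\<subseteq>W. ?matching t \<longrightarrow> (\<exists>x\<in>D. \<forall>w\<in>t. x \<notin> e w)"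
    show "odd (card D)"
    proof
      assume "even (card D)"
      then obtain n where n: "card D = 2 * n" by blast
      obtain C where C: "C \<subseteq> edges D" "\<Union>C = D" "disjoint C"
        using ex_perfect_matching[OF fin n] by (elim exE conjE)
      \<comment> \<open>The refuting state: the worlds whose edges form the perfect matching
        \<open>C\<close>.\<close>
      define t where "t = {w \<in> W. e w \<in> C}"
      have "?matching t"
      proof (intro ballI, rule ccontr)
        fix x y z
        assume "\<not> ((\<forall>w\<in>t. x = y) \<or> (\<forall>w\<in>t. x = z) \<or> (\<forall>w\<in>t. y = z) \<or>
           (\<forall>w\<in>t. \<not> (x \<in> e w \<and> y \<in> e w)) \<or> (\<forall>w\<in>t. \<not> (x \<in> e w \<and> z \<in> e w)))"
        then obtain u v where uv: "u \<in> t" "v \<in> t" "x \<in> e u" "y \<in> e u" "x \<in> e v" "z \<in> e v"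
          and neq: "x \<noteq> y" "x \<noteq> z" "y \<noteq> z" by auto
        \<comment> \<open>Both edges contain \<open>x\<close> and belong to the disjoint family
          \<open>C\<close>. Being equal, they would hold three distinct individuals.\<close>
        then have "e u = e v"
          using C(3) by (auto simp: t_def disjoint_def)
        then have sub: "{x, y, z} \<subseteq> e u"
          using uv by auto
        have "card (e u) = 2" "finite (e u)"
          using uv(1) edge fin by (auto simp: t_def intro: finite_subset)
        then have "card {x, y, z} \<le> 2"
          using card_mono[OF _ sub] by simp
        with neq show False by simp
      qed
      moreover have "t \<subseteq> W"
        by (auto simp: t_def)
      ultimately have "\<exists>x\<in>D. \<forall>w\<in>t. x \<notin> e w"
        using * by (elim allE impE)
      then obtain x where x: "x \<in> D" "\<forall>w\<in>t. x \<notin> e w"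
        by blast
      then obtain s where s: "s \<in> C" "x \<in> s"
        using C(2) by auto
      then have "s \<in> e ` W"
        using C(1) im by auto
      then obtain w where "w \<in> W" "e w = s"
        by auto
      with x(2) s show False
        by (auto simp: t_def)
    qed
  next
    assume odd: "odd (card D)"
    show "\<forall>t\<subseteq>W. ?matching t \<longrightarrow> (\<exists>x\<in>D. \<forall>w\<in>t. x \<notin> e w)"
    proof (intro allI impI, rule ccontr)
      fix t
      assume t: "t \<subseteq> W" and m: "?matching t" and cov: "\<not> (\<exists>x\<in>D. \<forall>w\<in>t. x \<notin> e w)"
      from cov have "D \<subseteq> \<Union>(e ` t)"
        by auto
      then have cover: "\<Union>(e ` t) = D"
        using edge(1) t by auto
      \<comment> \<open>Two distinct edges that meet have the form {x, y} and {x, z} with x, y, z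
        distinct, which contradicts \<open>m\<close>.\<close>
      have "disjoint (e ` t)"
        unfolding disjoint_def
      proof (intro ballI impI, elim imageE, hypsubst, rule ccontr)
        fix u v
        assume uv: "u \<in> t" "v \<in> t" "e u \<noteq> e v" "e u \<inter> e v \<noteq> {}"
        then obtain x where x: "x \<in> e u" "x \<in> e v" by blast
        have uvW: "u \<in> W" "v \<in> W" using uv t by auto
        obtain y where y: "e u = {x, y}" "y \<noteq> x"
          using x(1) edge(2)[OF uvW(1)] by (auto simp: card_2_iff doubleton_eq_iff)
        obtain z where z: "e v = {x, z}" "z \<noteq> x"
          using x(2) edge(2)[OF uvW(2)] by (auto simp: card_2_iff doubleton_eq_iff)
        have "x \<in> D" "y \<in> D" "z \<in> D"
          using y z edge(1) uvW by auto
        then show False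
          using m[rule_format, of x y z] y z uv(1-3) by auto
      qed
      then have "card (\<Union>(e ` t)) = 2 * card (e ` t)"
        using t edge(2) finW by (intro card_Union_edges) (auto intro: finite_subset)
      with cover odd show False by simp
    qed
  qed
  then have "inq_models (edge_model D W e) no_perfect_matching \<longleftrightarrow>
      (\<forall>g :: nat \<Rightarrow> _. (\<forall>x. g x \<in> D) \<longrightarrow> odd (card D))"
    by (simp only: inq_models_def supports_no_perfect_matching_iff edge_model_simps)
  \<comment> \<open>Nonemptiness of \<open>D\<close> provides an assignment, so the quantification
    over \<open>g\<close> is not vacuous.\<close>
  then show ?thesis
    using ex_assignment[OF ne] by simp
qed

section \<open>Back and forth\<close>

text \<open>Adding over connectives bounds the nesting depth of quantifiers from above. The coarser
  measure suffices, as \<open>partial_inj_mono\<close> discards surplus budget.\<close>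

fun quantifier_count :: "('r, 'f) tsfm \<Rightarrow> nat" where
  "quantifier_count (TNeg \<alpha>) = quantifier_count \<alpha>"
| "quantifier_count (TConj \<alpha> \<beta>) = quantifier_count \<alpha> + quantifier_count \<beta>"
| "quantifier_count (TDisj \<alpha> \<beta>) = quantifier_count \<alpha> + quantifier_count \<beta>"
| "quantifier_count (TImp \<alpha> \<beta>) = quantifier_count \<alpha> + quantifier_count \<beta>"
| "quantifier_count (TAllW v \<alpha>) = Suc (quantifier_count \<alpha>)"
| "quantifier_count (TExW v \<alpha>) = Suc (quantifier_count \<alpha>)"
| "quantifier_count (TAllE x \<alpha>) = Suc (quantifier_count \<alpha>)"
| "quantifier_count (TExE x \<alpha>) = Suc (quantifier_count \<alpha>)"
| "quantifier_count _ = 0"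

text \<open>A position of the game, with \<open>k\<close> the budget of fresh individuals left on
  both sides. As a relation, the map is reversed by \<open>r\<inverse>\<close>, which makes the two
  sides interchangeable.\<close>

definition partial_inj :: "'a set \<Rightarrow> 'b set \<Rightarrow> nat \<Rightarrow> ('a \<times> 'b) set \<Rightarrow> bool" where
  "partial_inj D D' k r \<longleftrightarrow>
     r \<subseteq> D \<times> D' \<and> single_valued r \<and> single_valued (r\<inverse>) \<and> finite r \<and>
     card r + k \<le> card D \<and> card r + k \<le> card D'"

lemma partial_inj_converse: "partial_inj D D' k r \<Longrightarrow> partial_inj D' D k (r\<inverse>)"
  by (auto simp: partial_inj_def)

lemma partial_inj_mono: "partial_inj D D' k r \<Longrightarrow> l \<le> k \<Longrightarrow> partial_inj D D' l r"
  by (auto simp: partial_inj_def)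

text \<open>Pigeonhole: \<open>Range r\<close> has fewer elements than \<open>D'\<close>, so an
  unmatched \<open>d\<close> finds a fresh partner. A matched \<open>d\<close> keeps its partner and
  the budget is merely lowered.\<close>

lemma partial_inj_extend:
  assumes "partial_inj D D' (Suc k) r" "d \<in> D"
  obtains r' d' where "partial_inj D D' k r'" "r \<subseteq> r'" "(d, d') \<in> r'" "d' \<in> D'"
proof (cases "d \<in> Domain r")
  case True
  then obtain d' where "(d, d') \<in> r" by blast
  then show thesis
    using that[of r d'] assms partial_inj_mono[OF assms(1), of k] by (auto simp: partial_inj_def)
next
  case False
  have r: "finite r" "card r + Suc k \<le> card D'"
    using assms by (auto simp: partial_inj_def)
  have "card (Range r) \<le> card r"
    using r(1) by (simp add: Range_snd card_image_le)
  then have "\<not> D' \<subseteq> Range r"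
    using r card_mono[OF finite_Range[OF r(1)], of D'] by auto
  then obtain d' where d': "d' \<in> D'" "d' \<notin> Range r" by blast
  have "partial_inj D D' k (insert (d, d') r)"
    using assms False d' by (auto simp: partial_inj_def single_valued_def card_insert_if)
  then show thesis
    using that[of "insert (d, d') r" d'] d' by auto
qed

text \<open>The pairing of worlds is derived from the partial injection on individuals, so no second
  relation has to be carried along.\<close>

definition related_worlds ::
  "('w \<Rightarrow> 'd set) \<Rightarrow> ('v \<Rightarrow> 'c set) \<Rightarrow> ('d \<times> 'c) set \<Rightarrow> 'w \<Rightarrow> 'v \<Rightarrow> bool" where
  "related_worlds e e' r w w' \<longleftrightarrow>
     (\<exists>a b a' b'. e w = {a, b} \<and> e' w' = {a', b'} \<and> (a, a') \<in> r \<and> (b, b') \<in> r)"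

lemma related_worlds_converse:
  "related_worlds e e' r w w' \<Longrightarrow> related_worlds e' e (r\<inverse>) w' w"
  unfolding related_worlds_def by blast

lemma related_worlds_mono:
  "related_worlds e e' r w w' \<Longrightarrow> r \<subseteq> r' \<Longrightarrow> related_worlds e e' r' w w'"
  unfolding related_worlds_def by blast

lemma related_worlds_mem_iff:
  assumes "partial_inj D D' k r" "related_worlds e e' r w w'" "(d, d') \<in> r"
  shows "d \<in> e w \<longleftrightarrow> d' \<in> e' w'"
  using assms by (auto simp: partial_inj_def related_worlds_def single_valued_def)

text \<open>Each edge is the image of its partner under \<open>r\<close> or
  \<open>r\<inverse>\<close>, so equality transfers both ways. This serves the equality atoms
  between worlds.\<close>

lemma related_worlds_eq_iff:
  assumes "partial_inj D D' k r" "related_worlds e e' r w w'" "related_worlds e e' r v v'"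
  shows "e w = e v \<longleftrightarrow> e' w' = e' v'"
proof -
  have image: "e' w' = r `` e w" "e w = r\<inverse> `` e' w'"
    if "related_worlds e e' r w w'" for w w'
    using that assms(1) by (auto simp: partial_inj_def related_worlds_def single_valued_def)
  show ?thesis
    using image[OF assms(2)] image[OF assms(3)] by metis
qed

text \<open>A world is matched by matching its two endpoints in turn, hence the price of two
  units.\<close>

lemma related_worlds_extend:
  assumes r: "partial_inj D D' (k + 2) r" and w: "w \<in> W"
    and e: "bij_betw e W (edges D)" and e': "bij_betw e' W' (edges D')"
  obtains r' w' where "partial_inj D D' k r'" "r \<subseteq> r'" "related_worlds e e' r' w w'" "w' \<in> W'"
proof -
  have "e w \<subseteq> D" "card (e w) = 2"
    using bij_betw_apply[OF e w] by auto
  then obtain a b where ab: "e w = {a, b}" "a \<noteq> b" "a \<in> D" "b \<in> D"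
    by (auto simp: card_2_iff)
  obtain r1 a' where r1: "partial_inj D D' (Suc k) r1" "r \<subseteq> r1" "(a, a') \<in> r1" "a' \<in> D'"
    using partial_inj_extend[of D D' "Suc k" r a] r ab by auto
  obtain r2 b' where r2: "partial_inj D D' k r2" "r1 \<subseteq> r2" "(b, b') \<in> r2" "b' \<in> D'"
    using partial_inj_extend[OF r1(1) ab(4)] by blast
  \<comment> \<open>Injectivity keeps the endpoints distinct, so they form an edge, which
    \<open>e'\<close> attains at some world.\<close>
  have "a' \<noteq> b'"
    using r1 r2 ab by (auto simp: partial_inj_def single_valued_def)
  then have "{a', b'} \<in> e' ` W'"
    using r1 r2 e' by (auto simp: bij_betw_def)
  then obtain w' where "w' \<in> W'" "e' w' = {a', b'}" by auto
  moreover from this have "related_worlds e e' r2 w w'"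
    using ab r1 r2 unfolding related_worlds_def by blast
  ultimately show thesis
    using that r1 r2 by blast
qed

text \<open>Only the variables in \<open>V\<close> and \<open>X\<close>, later the free ones, are
  constrained. For a sentence any assignments are related, even by the empty
  \<open>r\<close>.\<close>

definition related_envs ::
  "('w \<Rightarrow> 'd set) \<Rightarrow> ('v \<Rightarrow> 'c set) \<Rightarrow> 'w set \<Rightarrow> 'v set \<Rightarrow> ('d \<times> 'c) set \<Rightarrow> nat set \<Rightarrow> nat set \<Rightarrow>
    (nat \<Rightarrow> 'w) \<Rightarrow> (nat \<Rightarrow> 'v) \<Rightarrow> (nat \<Rightarrow> 'd) \<Rightarrow> (nat \<Rightarrow> 'c) \<Rightarrow> bool" where
  "related_envs e e' W W' r V X h h' g g' \<longleftrightarrow>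
     (\<forall>v\<in>V. h v \<in> W \<and> h' v \<in> W' \<and> related_worlds e e' r (h v) (h' v)) \<and>
     (\<forall>x\<in>X. (g x, g' x) \<in> r)"

lemma related_envs_subset:
  "related_envs e e' W W' r V X h h' g g' \<Longrightarrow> U \<subseteq> V \<Longrightarrow> Y \<subseteq> X \<Longrightarrow>
   related_envs e e' W W' r U Y h h' g g'"
  unfolding related_envs_def by blast

lemma related_envs_updW:
  "related_envs e e' W W' r (V - {v}) X h h' g g' \<Longrightarrow> r \<subseteq> r' \<Longrightarrow>
   related_worlds e e' r' w w' \<Longrightarrow> w \<in> W \<Longrightarrow> w' \<in> W' \<Longrightarrow>
   related_envs e e' W W' r' V X (h(v := w)) (h'(v := w')) g g'"
  unfolding related_envs_def by (auto intro: related_worlds_mono)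

lemma related_envs_updE:
  "related_envs e e' W W' r V (X - {x}) h h' g g' \<Longrightarrow> r \<subseteq> r' \<Longrightarrow> (d, d') \<in> r' \<Longrightarrow>
   related_envs e e' W W' r' V X h h' (g(x := d)) (g'(x := d'))"
  unfolding related_envs_def by (auto intro: related_worlds_mono)

text \<open>\<open>P\<close> and \<open>P'\<close> stand for truth of the body in the two
  structures, so that one zig-zag argument yields both quantifiers.\<close>

lemma back_and_forth_worlds:
  assumes e: "bij_betw e W (edges D)" and e': "bij_betw e' W' (edges D')"
    and IH: "\<And>r h h'. partial_inj D D' k r \<Longrightarrow> related_envs e e' W W' r V X h h' g g' \<Longrightarrow>
      P h \<longleftrightarrow> P' h'"
    and r: "partial_inj D D' (k + 2) r" and env: "related_envs e e' W W' r (V - {v}) X h h' g g'"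
  shows "(\<exists>w\<in>W. P (h(v := w))) \<longleftrightarrow> (\<exists>w\<in>W'. P' (h'(v := w)))"
    and "(\<forall>w\<in>W. P (h(v := w))) \<longleftrightarrow> (\<forall>w\<in>W'. P' (h'(v := w)))"
proof -
  have zig: "\<exists>w'\<in>W'. P (h(v := w)) \<longleftrightarrow> P' (h'(v := w'))" if w: "w \<in> W" for w
  proof -
    obtain r' w' where "partial_inj D D' k r'" "r \<subseteq> r'" "related_worlds e e' r' w w'" "w' \<in> W'"
      using related_worlds_extend[OF r w e e'] .
    then show ?thesis
      using IH related_envs_updW[OF env] w by blast
  qed
  \<comment> \<open>Mirror image of \<open>zig\<close>: the position is reversed, extended and
    reversed back.\<close>
  have zag: "\<exists>w\<in>W. P (h(v := w)) \<longleftrightarrow> P' (h'(v := w'))" if w': "w' \<in> W'" for w'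
  proof -
    obtain r' w where *: "partial_inj D' D k r'" "r\<inverse> \<subseteq> r'" "related_worlds e' e r' w' w" "w \<in> W"
      using related_worlds_extend[OF partial_inj_converse[OF r] w' e' e] .
    have "partial_inj D D' k (r'\<inverse>)" "r \<subseteq> r'\<inverse>" "related_worlds e e' (r'\<inverse>) w w'"
      using partial_inj_converse[OF *(1)] *(2) related_worlds_converse[OF *(3)] by auto
    then show ?thesis
      using IH related_envs_updW[OF env] w' *(4) by blast
  qed
  show "(\<exists>w\<in>W. P (h(v := w))) \<longleftrightarrow> (\<exists>w\<in>W'. P' (h'(v := w)))"
    and "(\<forall>w\<in>W. P (h(v := w))) \<longleftrightarrow> (\<forall>w\<in>W'. P' (h'(v := w)))"
    using zig zag by metis+
qed

lemma back_and_forth_indivs: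
  assumes IH: "\<And>r g g'. partial_inj D D' k r \<Longrightarrow> related_envs e e' W W' r V X h h' g g' \<Longrightarrow>
      P g \<longleftrightarrow> P' g'"
    and r: "partial_inj D D' (Suc k) r" and env: "related_envs e e' W W' r V (X - {x}) h h' g g'"
  shows "(\<exists>d\<in>D. P (g(x := d))) \<longleftrightarrow> (\<exists>d\<in>D'. P' (g'(x := d)))"
    and "(\<forall>d\<in>D. P (g(x := d))) \<longleftrightarrow> (\<forall>d\<in>D'. P' (g'(x := d)))"
proof -
  have zig: "\<exists>d'\<in>D'. P (g(x := d)) \<longleftrightarrow> P' (g'(x := d'))" if d: "d \<in> D" for d
  proof -
    obtain r' d' where "partial_inj D D' k r'" "r \<subseteq> r'" "(d, d') \<in> r'" "d' \<in> D'"
      using partial_inj_extend[OF r d] .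
    then show ?thesis
      using IH related_envs_updE[OF env] by blast
  qed
  have zag: "\<exists>d\<in>D. P (g(x := d)) \<longleftrightarrow> P' (g'(x := d'))" if d': "d' \<in> D'" for d'
  proof -
    obtain r' d where *: "partial_inj D' D k r'" "r\<inverse> \<subseteq> r'" "(d', d) \<in> r'" "d \<in> D"
      using partial_inj_extend[OF partial_inj_converse[OF r] d'] .
    have "partial_inj D D' k (r'\<inverse>)" "r \<subseteq> r'\<inverse>" "(d, d') \<in> r'\<inverse>"
      using partial_inj_converse[OF *(1)] *(2,3) by auto
    then show ?thesis
      using IH related_envs_updE[OF env] *(4) by blast
  qed
  show "(\<exists>d\<in>D. P (g(x := d))) \<longleftrightarrow> (\<exists>d\<in>D'. P' (g'(x := d)))"
    and "(\<forall>d\<in>D. P (g(x := d))) \<longleftrightarrow> (\<forall>d\<in>D'. P' (g'(x := d)))"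
    using zig zag by metis+
qed

section \<open>Agreement of two edge models on two-sorted formulas\<close>

lemma etrm_over_edge_sig: "etrm_over edge_sig t \<longleftrightarrow> (\<exists>x. t = EVar x)"
  by (cases t) (auto simp: edge_sig_def)

lemma encoding_edge_model_simps [simp]:
  "domW (encoding (edge_model D W e)) = W"
  "domE (encoding (edge_model D W e)) = D"
  "(w, [d]) \<in> ts_rel (encoding (edge_model D W e)) R \<longleftrightarrow> w \<in> W \<and> d \<in> e w"
  by (simp_all add: encoding_def)

text \<open>By induction on \<open>\<alpha>\<close>, each quantifier being a move in the game. The
  factor 2 pays for the endpoints of a chosen world.\<close>

lemma ts_sat_edge_model_iff:
  fixes D :: "'d set" and D' :: "'c set" and W :: "'w set" and W' :: "'v set"
  assumes e: "bij_betw e W (edges D)" and e': "bij_betw e' W' (edges D')"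
  shows "tsfm_over edge_sig \<alpha> \<Longrightarrow> partial_inj D D' (2 * quantifier_count \<alpha>) r \<Longrightarrow>
    related_envs e e' W W' r (tsfm_fvW \<alpha>) (tsfm_fvE \<alpha>) h h' g g' \<Longrightarrow>
    ts_sat (encoding (edge_model D W e)) h g \<alpha> \<longleftrightarrow>
    ts_sat (encoding (edge_model D' W' e')) h' g' \<alpha>"
proof (induction \<alpha> arbitrary: r h h' g g')
  case (TRel R v ts)
  have "length ts = 1" "\<forall>t\<in>set ts. \<exists>x. t = EVar x"
    using TRel.prems(1) by (simp_all add: etrm_over_edge_sig) (simp add: edge_sig_def)
  then obtain x where ts: "ts = [EVar x]"
    by (auto simp: length_Suc_conv)
  with TRel.prems(3) have "h v \<in> W" "h' v \<in> W'" "related_worlds e e' r (h v) (h' v)"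
    "(g x, g' x) \<in> r"
    by (auto simp: related_envs_def)
  then show ?case
    using related_worlds_mem_iff[OF TRel.prems(2)] ts by simp
next
  case (TEqW u v)
  then have *: "h u \<in> W" "h v \<in> W" "h' u \<in> W'" "h' v \<in> W'"
    "related_worlds e e' r (h u) (h' u)" "related_worlds e e' r (h v) (h' v)"
    by (auto simp: related_envs_def)
  \<comment> \<open>Labels are injective, so equality of worlds reduces to equality of
    edges.\<close>
  have "h u = h v \<longleftrightarrow> e (h u) = e (h v)" "h' u = h' v \<longleftrightarrow> e' (h' u) = e' (h' v)"
    using * e e' by (auto simp: bij_betw_def inj_on_def)
  then show ?case
    using related_worlds_eq_iff[OF TEqW.prems(2) *(5,6)] by simp
next
  case (TEqE t u)
  then obtain x y where tu: "t = EVar x" "u = EVar y"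
    by (auto simp: etrm_over_edge_sig)
  then have "(g x, g' x) \<in> r" "(g y, g' y) \<in> r"
    using TEqE.prems(3) by (auto simp: related_envs_def)
  then show ?case
    using TEqE.prems(2) tu by (auto simp: partial_inj_def single_valued_def)
next
  case TBot
  then show ?case by simp
next
  case (TNeg \<alpha>)
  then show ?case by simp
next
  case (TConj \<alpha> \<beta>)
  have "partial_inj D D' (2 * quantifier_count \<alpha>) r" "partial_inj D D' (2 * quantifier_count \<beta>) r"
    using TConj.prems(2) by (auto elim: partial_inj_mono)
  moreover have "related_envs e e' W W' r (tsfm_fvW \<alpha>) (tsfm_fvE \<alpha>) h h' g g'"
    "related_envs e e' W W' r (tsfm_fvW \<beta>) (tsfm_fvE \<beta>) h h' g g'"
    using related_envs_subset[OF TConj.prems(3)] by auto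
  ultimately show ?case
    using TConj.IH TConj.prems(1) by simp
next
  case (TDisj \<alpha> \<beta>)
  have "partial_inj D D' (2 * quantifier_count \<alpha>) r" "partial_inj D D' (2 * quantifier_count \<beta>) r"
    using TDisj.prems(2) by (auto elim: partial_inj_mono)
  moreover have "related_envs e e' W W' r (tsfm_fvW \<alpha>) (tsfm_fvE \<alpha>) h h' g g'"
    "related_envs e e' W W' r (tsfm_fvW \<beta>) (tsfm_fvE \<beta>) h h' g g'"
    using related_envs_subset[OF TDisj.prems(3)] by auto
  ultimately show ?case
    using TDisj.IH TDisj.prems(1) by simp
next
  case (TImp \<alpha> \<beta>)
  have "partial_inj D D' (2 * quantifier_count \<alpha>) r" "partial_inj D D' (2 * quantifier_count \<beta>) r"
    using TImp.prems(2) by (auto elim: partial_inj_mono)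
  moreover have "related_envs e e' W W' r (tsfm_fvW \<alpha>) (tsfm_fvE \<alpha>) h h' g g'"
    "related_envs e e' W W' r (tsfm_fvW \<beta>) (tsfm_fvE \<beta>) h h' g g'"
    using related_envs_subset[OF TImp.prems(3)] by auto
  ultimately show ?case
    using TImp.IH TImp.prems(1) by simp
next
  case (TAllW v \<alpha>)
  have "partial_inj D D' (2 * quantifier_count \<alpha> + 2) r"
    using TAllW.prems(2) by simp
  then show ?case
    using back_and_forth_worlds(2)[OF e e' TAllW.IH] TAllW.prems(1,3) by simp
next
  case (TExW v \<alpha>)
  have "partial_inj D D' (2 * quantifier_count \<alpha> + 2) r"
    using TExW.prems(2) by simp
  then show ?case
    using back_and_forth_worlds(1)[OF e e' TExW.IH] TExW.prems(1,3) by simp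
next
  case (TAllE x \<alpha>)
  \<comment> \<open>An individual costs one unit while two are set aside for the quantifier; the
    other is discarded.\<close>
  have "partial_inj D D' (Suc (2 * quantifier_count \<alpha>)) r"
    using TAllE.prems(2) by (auto elim: partial_inj_mono)
  then show ?case
    using back_and_forth_indivs(2)[OF TAllE.IH] TAllE.prems(1,3) by simp
next
  case (TExE x \<alpha>)
  have "partial_inj D D' (Suc (2 * quantifier_count \<alpha>)) r"
    using TExE.prems(2) by (auto elim: partial_inj_mono)
  then show ?case
    using back_and_forth_indivs(1)[OF TExE.IH] TExE.prems(1,3) by simp
qed

(* HOL cannot quantify over types inside a formula, so worlds and individuals are drawn from
   arbitrary infinite types 'w and 'd; a model is any pair of non-empty subsets of these with an
   interpretation. *)
theorem theorem4:
  assumes "infinite (UNIV :: 'w set)" and "infinite (UNIV :: 'd set)"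
  shows "\<exists>(\<Sigma> :: (nat, nat) signature) \<phi>. inq_sentence \<Sigma> \<phi> \<and>
    \<not> (\<exists>\<phi>'. ts_sentence \<Sigma> \<phi>' \<and>
         (\<forall>M :: ('w, 'd, nat, nat) info_model. is_info_model \<Sigma> M \<longrightarrow>
            (inq_models M \<phi> \<longleftrightarrow> ts_models (encoding M) \<phi>')))"
proof (intro exI conjI notI)
  show "inq_sentence edge_sig no_perfect_matching"
    by (rule no_perfect_matching_sentence)
next
  assume "\<exists>\<phi>'. ts_sentence edge_sig \<phi>' \<and>
         (\<forall>M :: ('w, 'd, nat, nat) info_model. is_info_model edge_sig M \<longrightarrow>
            (inq_models M no_perfect_matching \<longleftrightarrow> ts_models (encoding M) \<phi>'))"
  then obtain \<phi>' where \<phi>': "ts_sentence edge_sig \<phi>'"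
    and def: "\<And>M :: ('w, 'd, nat, nat) info_model. is_info_model edge_sig M \<Longrightarrow>
      inq_models M no_perfect_matching \<longleftrightarrow> ts_models (encoding M) \<phi>'"
    by blast
  \<comment> \<open>Size at least 2 guarantees an edge, hence the nonempty set of worlds that a
    model requires.\<close>
  have ex: "\<exists>(D :: 'd set) (W :: 'w set) e. finite D \<and> card D = n \<and> D \<noteq> {} \<and> W \<noteq> {} \<and>
      bij_betw e W (edges D)" if n: "n \<ge> 2" for n
  proof -
    obtain D :: "'d set" where D: "finite D" "card D = n"
      using infinite_arbitrarily_large[OF assms(2)] by blast
    obtain W :: "'w set" and e where e: "bij_betw e W (edges D)"
      using ex_edge_labelling[OF assms(1) D(1)] .
    have "edges D \<noteq> {}"
      using obtain_subset_with_card_n[of 2 D] D n by auto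
    with e have "W \<noteq> {}"
      by (auto simp: bij_betw_def)
    moreover have "D \<noteq> {}"
      using D n by auto
    ultimately show ?thesis
      using D e by blast
  qed
  \<comment> \<open>The multiple of 2 is the whole budget, and 2 more guarantees an edge. Thus
    \<open>n\<close> is even and \<open>Suc n\<close> odd, and both sizes leave enough room.\<close>
  define n where "n = 2 * quantifier_count \<phi>' + 2"
  obtain D :: "'d set" and W :: "'w set" and e
    where D: "finite D" "card D = n" "D \<noteq> {}" "W \<noteq> {}" and e: "bij_betw e W (edges D)"
    using ex[of n] by (auto simp: n_def)
  obtain D' :: "'d set" and W' :: "'w set" and e'
    where D': "finite D'" "card D' = Suc n" "D' \<noteq> {}" "W' \<noteq> {}"
      and e': "bij_betw e' W' (edges D')"
    using ex[of "Suc n"] by (auto simp: n_def)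
  \<comment> \<open>The game starts from the empty map; as \<open>\<phi>'\<close> has no free
    variables, arbitrary assignments can be compared.\<close>
  have "partial_inj D D' (2 * quantifier_count \<phi>') {}"
    using D D' by (simp add: partial_inj_def n_def)
  then have sat: "ts_sat (encoding (edge_model D W e)) h g \<phi>' \<longleftrightarrow>
      ts_sat (encoding (edge_model D' W' e')) h' g' \<phi>'" for h h' g g'
    using ts_sat_edge_model_iff[OF e e'] \<phi>' by (simp add: ts_sentence_def related_envs_def)
  have "ts_models (encoding (edge_model D W e)) \<phi>' \<longleftrightarrow>
      ts_models (encoding (edge_model D' W' e')) \<phi>'"
  proof -
    \<comment> \<open>\<open>ts_models\<close> quantifies over all assignments; their existence on
      both sides rules out vacuous truth.\<close>
    have "\<exists>h :: nat \<Rightarrow> 'w. \<forall>v. h v \<in> W" "\<exists>h :: nat \<Rightarrow> 'w. \<forall>v. h v \<in> W'"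
      "\<exists>g :: nat \<Rightarrow> 'd. \<forall>x. g x \<in> D" "\<exists>g :: nat \<Rightarrow> 'd. \<forall>x. g x \<in> D'"
      using D D' by (auto intro!: ex_assignment)
    then show ?thesis
      unfolding ts_models_def encoding_edge_model_simps using sat by blast
  qed
  moreover have "ts_models (encoding (edge_model D W e)) \<phi>' \<longleftrightarrow> odd (card D)"
    using def edge_model_is_info_model[OF D(3,4) e] inq_models_no_perfect_matching_iff[OF D(1,3) e]
    by blast
  moreover have "ts_models (encoding (edge_model D' W' e')) \<phi>' \<longleftrightarrow> odd (card D')"
    using def edge_model_is_info_model[OF D'(3,4) e']
      inq_models_no_perfect_matching_iff[OF D'(1,3) e'] by blast
  ultimately show False
    using D D' by simp
qed

end
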